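(* Let $A$ and $B$ be $n\times n$ complex Hermitian matrices. Then the entries of the vector $\delta(B;A)$ are the diagonal entries of $B$ in a certain orthonormal basis in which $A$ is diagonal with its diagonal entries sorted in non-increasing order; that is, there exists a unitary matrix $U$ such that $U^*AU$ is the diagonal matrix with diagonal $(\lambda_1^\downarrow(A),\dots,\lambda_n^\downarrow(A))$ and $\delta_j(B;A)=(U^*BU)_{jj}$ for all $j=1,\dots,n$. When all eigenvalues of $A$ are simple (i.e. have multiplicity $1$), this basis is just the eigenbasis of $A$ (unique up to phase factors of the basis vectors) and does not depend on $B$.
   Context: For an $n\times n$ Hermitian matrix $X$, $\lambda_1^\downarrow(X)\ge\cdots\ge\lambda_n^\downarrow(X)$ denote its eigenvalues, counted with multiplicity, in non-increasing order. For Hermitian $A,B$ the vector $\delta(B;A)=(\delta_1(B;A),\dots,\delta_n(B;A))\in\mathbb{R}^n$ is defined by requiring, for all $k=1,\dots,n$, $$\sum_{j=1}^k \delta_j(B;A) = \lim_{t\to 0^+}\frac1t\sum_{j=1}^k\left(\lambda_j^\downarrow(A+tB)-\lambda_j^\downarrow(A)\right)$$ (the one-sided directional derivative at $A$ in direction $B$ of the sum of the $k$ largest eigenvalues, which is a convex function, so the limit exists). *)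

theory Defs
  imports
    "Jordan_Normal_Form.Schur_Decomposition"
    "HOL-Computational_Algebra.Fundamental_Theorem_Algebra"
begin

definition hermitian_mat :: "nat \<Rightarrow> complex mat \<Rightarrow> bool" where
  "hermitian_mat n A \<longleftrightarrow> A \<in> carrier_mat n n \<and> mat_adjoint A = A"

definition unitary_mat :: "nat \<Rightarrow> complex mat \<Rightarrow> bool" where
  "unitary_mat n U \<longleftrightarrow> U \<in> carrier_mat n n \<and> mat_adjoint U * U = 1\<^sub>m n \<and> U * mat_adjoint U = 1\<^sub>m n"

text \<open>The eigenvalues with multiplicity are the roots of the characteristic polynomial.
  They are real for a Hermitian matrix, so that taking real parts loses nothing there;
  for other matrices the definition is not meaningful. Indices start at \<open>0\<close>, as for the
  rows and columns of a matrix: \<open>eigval_down A j\<close> is the \<open>(j+1)\<close>-st largest eigenvalue.\<close>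

definition eigvals_down :: "complex mat \<Rightarrow> real list" where
  "eigvals_down A = rev (sorted_list_of_multiset (image_mset Re (proots (char_poly A))))"

definition eigval_down :: "complex mat \<Rightarrow> nat \<Rightarrow> real" where
  "eigval_down A j = eigvals_down A ! j"

lemma length_eigvals_down:
  assumes "A \<in> carrier_mat n n"
  shows "length (eigvals_down A) = n"
proof -
  have "length (eigvals_down A) = size (proots (char_poly A))"
    unfolding eigvals_down_def
    by (simp flip: size_mset)
  then show ?thesis
    using degree_monic_char_poly[OF assms] by (simp add: size_proots_complex)
qed

definition is_delta :: "complex mat \<Rightarrow> complex mat \<Rightarrow> real vec \<Rightarrow> bool" where
  "is_delta B A d \<longleftrightarrow> d \<in> carrier_vec (dim_row A) \<and>
     (\<forall>k\<in>{1..dim_row A}.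
        ((\<lambda>t::real. 1 / t *
            (\<Sum>j<k. eigval_down (A + complex_of_real t \<cdot>\<^sub>m B) j - eigval_down A j))
          \<longlongrightarrow> (\<Sum>j<k. d $ j)) (at_right 0))"

text \<open>As in the notation \<open>\<delta>(B;A)\<close>, the direction \<open>B\<close> comes first and the base point \<open>A\<close> second.\<close>

definition delta :: "complex mat \<Rightarrow> complex mat \<Rightarrow> real vec" where
  "delta B A = (THE d. is_delta B A d)"

lemma is_delta_unique:
  assumes d: "is_delta B A d" and e: "is_delta B A e"
  shows "d = e"
proof (rule eq_vecI)
  have dims: "dim_vec d = dim_row A" "dim_vec e = dim_row A"
    using d e by (auto simp: is_delta_def)
  then show "dim_vec d = dim_vec e" by simp
  have sums: "(\<Sum>j<k. d $ j) = (\<Sum>j<k. e $ j)" if "k \<le> dim_row A" for k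
  proof (cases "k = 0")
    case False
    with that have k: "k \<in> {1..dim_row A}" by simp
    let ?f = "\<lambda>t::real. 1 / t *
        (\<Sum>j<k. eigval_down (A + complex_of_real t \<cdot>\<^sub>m B) j - eigval_down A j)"
    have "(?f \<longlongrightarrow> (\<Sum>j<k. d $ j)) (at_right 0)" "(?f \<longlongrightarrow> (\<Sum>j<k. e $ j)) (at_right 0)"
      using d e k unfolding is_delta_def by blast+
    then show ?thesis
      by (rule tendsto_unique[OF trivial_limit_at_right_real])
  qed simp
  fix i assume "i < dim_vec e"
  then show "d $ i = e $ i"
    using sums[of i] sums[of "Suc i"] dims by simp
qed

lemma delta_eqI: "is_delta B A d \<Longrightarrow> delta B A = d"
  unfolding delta_def by (rule the_equality) (auto intro: is_delta_unique)

text \<open>An orthonormal basis is given as the columns of a unitary matrix.\<close>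

definition sorted_diagonalizes :: "nat \<Rightarrow> complex mat \<Rightarrow> complex mat \<Rightarrow> bool" where
  "sorted_diagonalizes n U A \<longleftrightarrow> unitary_mat n U \<and>
     mat_adjoint U * A * U = mat_diag n (\<lambda>j. complex_of_real (eigval_down A j))"

definition sorted_eigenbasis :: "nat \<Rightarrow> complex mat \<Rightarrow> complex mat \<Rightarrow> bool" where
  "sorted_eigenbasis n U A \<longleftrightarrow> unitary_mat n U \<and>
     (\<forall>j<n. eigenvector A (col U j) (complex_of_real (eigval_down A j)))"

definition simple_spectrum :: "complex mat \<Rightarrow> bool" where
  "simple_spectrum A \<longleftrightarrow> (\<forall>x. eigenvalue A x \<longrightarrow> Polynomial.order x (char_poly A) = 1)"

end

theory Submission
  imports Defs
begin

text \<open>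
  By Ky Fan's inequality, the sum \<open>s\<^sub>k(X)\<close> of the \<open>k\<close> largest eigenvalues of a Hermitian matrix
  \<open>X\<close> is the maximum of \<open>\<Sum>\<^sub>j\<^sub><\<^sub>k (G\<^sup>* X G)\<^sub>j\<^sub>j\<close> over unitary \<open>G\<close>. Choose \<open>G\<^sub>t\<close> diagonalizing \<open>A + t B\<close> in
  sorted order and let \<open>U\<close> be a limit point of \<open>G\<^sub>t\<close> as \<open>t \<rightarrow> 0\<close>, which exists by compactness; \<open>U\<close> then
  diagonalizes \<open>A\<close> in sorted order. Using \<open>U\<close> as a competitor for \<open>A + t B\<close>, and \<open>G\<^sub>t\<close> as a competitor
  for \<open>A\<close> and for other multiples of \<open>B\<close>, the difference quotient of \<open>s\<^sub>k\<close> is squeezed between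
  \<open>\<Sum>\<^sub>j\<^sub><\<^sub>k (U\<^sup>* B U)\<^sub>j\<^sub>j\<close> and \<open>\<Sum>\<^sub>j\<^sub><\<^sub>k (G\<^sub>u\<^sup>* B G\<^sub>u)\<^sub>j\<^sub>j\<close> for all \<open>u \<ge> t\<close>. Hence the one limit point \<open>U\<close> yields
  all the directional derivatives at once. For a simple spectrum, phase factors do not change the
  diagonal entries of \<open>U\<^sup>* B U\<close>, so any sorted eigenbasis may replace \<open>U\<close>.
\<close>

subsection \<open>Unitary diagonalization of Hermitian matrices\<close>

lemma index_mult_mat_sum:
  assumes "A \<in> carrier_mat n m" "B \<in> carrier_mat m p" "i < n" "j < p"
  shows "(A * B) $$ (i, j) = (\<Sum>l<m. A $$ (i, l) * B $$ (l, j))"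
  using assms by (auto simp: scalar_prod_def atLeast0LessThan intro!: sum.cong)

lemma mat_adjoint_carrier [simp]:
  "A \<in> carrier_mat n m \<Longrightarrow> mat_adjoint A \<in> carrier_mat m n"
  by (auto simp: mat_adjoint_def)

lemma mat_adjoint_dim [simp]:
  "dim_row (mat_adjoint A) = dim_col A" "dim_col (mat_adjoint A) = dim_row A"
  by (auto simp: mat_adjoint_def)

lemma index_mat_adjoint [simp]:
  fixes A :: "complex mat"
  shows "i < dim_col A \<Longrightarrow> j < dim_row A \<Longrightarrow> mat_adjoint A $$ (i, j) = cnj (A $$ (j, i))"
  by (simp add: mat_adjoint_def mat_of_rows_def)

lemma mat_adjoint_adjoint [simp]:
  fixes A :: "complex mat"
  shows "mat_adjoint (mat_adjoint A) = A"
  by (rule eq_matI) auto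

lemma mat_adjoint_mult:
  fixes A B :: "complex mat"
  assumes "A \<in> carrier_mat n m" "B \<in> carrier_mat m p"
  shows "mat_adjoint (A * B) = mat_adjoint B * mat_adjoint A"
proof (rule eq_matI)
  fix i j assume "i < dim_row (mat_adjoint B * mat_adjoint A)" "j < dim_col (mat_adjoint B * mat_adjoint A)"
  then have "i < p" "j < n" using assms by auto
  then show "mat_adjoint (A * B) $$ (i, j) = (mat_adjoint B * mat_adjoint A) $$ (i, j)"
    using assms
    by (auto simp: index_mult_mat_sum[OF assms] mult.commute
        index_mult_mat_sum[OF mat_adjoint_carrier[OF assms(2)] mat_adjoint_carrier[OF assms(1)]]
        simp del: index_mult_mat(1) intro!: sum.cong)
qed (use assms in auto)

lemma index_adjoint_mult:
  fixes A B :: "complex mat"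
  assumes "A \<in> carrier_mat m n" "B \<in> carrier_mat m p" "i < n" "j < p"
  shows "(mat_adjoint A * B) $$ (i, j) = (\<Sum>l<m. cnj (A $$ (l, i)) * B $$ (l, j))"
  using assms
  by (subst index_mult_mat_sum[OF mat_adjoint_carrier[OF assms(1)] assms(2-4)]) (auto intro!: sum.cong)

lemma unitary_matI:
  assumes "U \<in> carrier_mat n n" "mat_adjoint U * U = 1\<^sub>m n"
  shows "unitary_mat n U"
  using assms mat_mult_left_right_inverse[of "mat_adjoint U" n U]
  by (auto simp: unitary_mat_def)

lemma unitary_matD:
  assumes "unitary_mat n U"
  shows "U \<in> carrier_mat n n" "mat_adjoint U \<in> carrier_mat n n"
    "mat_adjoint U * U = 1\<^sub>m n" "U * mat_adjoint U = 1\<^sub>m n"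
  using assms by (auto simp: unitary_mat_def)

lemma unitary_mat_mult:
  assumes U: "unitary_mat n U" and V: "unitary_mat n V"
  shows "unitary_mat n (U * V)"
proof (rule unitary_matI)
  note c = unitary_matD[OF U] unitary_matD[OF V]
  show "U * V \<in> carrier_mat n n" using c by auto
  have "mat_adjoint U * (U * V) = V"
    using c by (simp flip: assoc_mult_mat[of _ n n _ n _ n])
  then show "mat_adjoint (U * V) * (U * V) = 1\<^sub>m n"
    using c by (simp add: mat_adjoint_mult[of _ n n _ n] assoc_mult_mat[of _ n n _ n _ n])
qed

lemma adjoint_mult_conjugate:
  fixes A :: "complex mat"
  assumes "A \<in> carrier_mat n n" "U \<in> carrier_mat n n" "V \<in> carrier_mat n n"
  shows "mat_adjoint (U * V) * A * (U * V) = mat_adjoint V * (mat_adjoint U * A * U) * V"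
  using assms
  by (simp add: mat_adjoint_mult[of _ n n _ n] assoc_mult_mat[of _ n n _ n _ n]
      mult_carrier_mat[of _ n n _ n])

lemma unitary_mat_adjoint: "unitary_mat n U \<Longrightarrow> unitary_mat n (mat_adjoint U)"
  by (auto simp: unitary_mat_def)

lemma hermitian_conjugate:
  assumes "hermitian_mat n A" "U \<in> carrier_mat n n"
  shows "hermitian_mat n (mat_adjoint U * A * U)"
  using assms
  by (auto simp: hermitian_mat_def mat_adjoint_mult[of _ n n _ n] assoc_mult_mat[of _ n n _ n _ n])

lemma hermitian_index:
  assumes "hermitian_mat n A" "i < n" "j < n"
  shows "cnj (A $$ (i, j)) = A $$ (j, i)"
  using assms index_mat_adjoint[of j A i] by (auto simp: hermitian_mat_def)

lemma hermitian_diag_real: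
  assumes "hermitian_mat n A" "i < n"
  shows "complex_of_real (Re (A $$ (i, i))) = A $$ (i, i)"
  using hermitian_index[OF assms(1,2,2)] by (metis complex_cnj_cancel_iff Reals_cnj_iff of_real_Re)

section \<open>The spectral theorem by deflation\<close>

text \<open>Gram-Schmidt keeps the head of a basis that starts with \<open>v\<close>; normalizing
  the result leaves \<open>c\<close> as the factor on \<open>v\<close>. For an eigenvector
  \<open>v\<close>, this splits off one eigenvalue.\<close>

lemma unitary_with_first_col:
  fixes v :: "complex vec"
  assumes v: "v \<in> carrier_vec n" and v0: "v \<noteq> 0\<^sub>v n"
  shows "\<exists>W c. unitary_mat n W \<and> col W 0 = c \<cdot>\<^sub>v v"
proof -
  interpret cof_vec_space n "TYPE(complex)" .
  define b where "b = basis_completion v"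
  define ws where "ws = gram_schmidt n b"
  from basis_completion[OF v v0, folded b_def]
  have dist_b: "distinct b" and indep: "\<not> lin_dep (set b)" and b: "set b \<subseteq> carrier_vec n"
    and hdb: "hd b = v" and len_b: "length b = n" by auto
  have n: "n \<noteq> 0" using v v0 by auto
  with hdb len_b obtain vs where bv: "b = v # vs" by (cases b) auto
  from gram_schmidt_result[OF b dist_b indep refl, folded ws_def]
  have ws: "set ws \<subseteq> carrier_vec n" "corthogonal ws" "length ws = n"
    by (auto simp: len_b)
  have hdws: "hd ws = v" using gram_schmidt_hd[OF v, of vs, folded bv] unfolding ws_def .
  have ws0: "ws ! 0 = v" using hdws ws(3) n by (cases ws) auto
  have wsc: "ws ! i \<in> carrier_vec n" if "i < n" for i using ws that by (auto dest: nth_mem)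
  \<comment> \<open>The vectors in \<open>ws\<close> are orthogonal but not normalized, so
    \<open>f w\<close> is the reciprocal norm of \<open>w\<close>; \<open>Re\<close> only extracts
    the real number \<open>w \<bullet>c w\<close>.\<close>
  define f where "f w = complex_of_real (1 / sqrt (Re (w \<bullet>c w)))" for w :: "complex vec"
  define W where "W = mat_of_cols n (map (\<lambda>w. f w \<cdot>\<^sub>v w) ws)"
  have W: "W \<in> carrier_mat n n" using ws unfolding W_def by (auto simp: mat_of_cols_def)
  have Wi: "W $$ (l, i) = f (ws ! i) * ws ! i $ l" if "l < n" "i < n" for l i
    using that ws wsc[of i] by (auto simp: W_def mat_of_cols_index)
  have "mat_adjoint W * W = 1\<^sub>m n"
  proof (rule eq_matI)
    fix i j assume "i < dim_row (1\<^sub>m n :: complex mat)" "j < dim_col (1\<^sub>m n :: complex mat)"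
    then have ij: "i < n" "j < n" by auto
    have "(mat_adjoint W * W) $$ (i, j) = (\<Sum>l<n. cnj (W $$ (l, i)) * W $$ (l, j))"
      by (rule index_adjoint_mult[OF W W ij])
    also have "\<dots> = cnj (f (ws ! i)) * f (ws ! j) * (\<Sum>l<n. ws ! j $ l * cnj (ws ! i $ l))"
      unfolding sum_distrib_left using ij by (intro sum.cong) (auto simp: Wi)
    also have "(\<Sum>l<n. ws ! j $ l * cnj (ws ! i $ l)) = ws ! j \<bullet>c ws ! i"
      using wsc[OF ij(1)] by (auto simp: scalar_prod_def atLeast0LessThan intro!: sum.cong)
    finally have eq: "(mat_adjoint W * W) $$ (i, j) = cnj (f (ws ! i)) * f (ws ! j) * (ws ! j \<bullet>c ws ! i)" .
    show "(mat_adjoint W * W) $$ (i, j) = 1\<^sub>m n $$ (i, j)"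
    proof (cases "i = j")
      case True
      have "ws ! i \<bullet>c ws ! i \<noteq> 0" using corthogonalD[OF ws(2), of i i] ij ws by auto
      moreover have "ws ! i \<bullet>c ws ! i \<ge> 0" by auto
      ultimately obtain r where r: "ws ! i \<bullet>c ws ! i = complex_of_real r" "r > 0"
        by (metis complex_eq_iff complex_of_real_def complex.sel less_eq_complex_def less_le zero_complex.sel)
      have "cnj (f (ws ! i)) * f (ws ! i) * complex_of_real r = complex_of_real (1 / sqrt r * (1 / sqrt r) * r)"
        unfolding f_def r(1) Re_complex_of_real of_real_mult complex_cnj_complex_of_real by (rule refl)
      also have "1 / sqrt r * (1 / sqrt r) * r = 1" using r(2) by (simp add: field_simps)
      finally show ?thesis using eq True ij r by simp
    next
      case False
      then show ?thesis using eq corthogonalD[OF ws(2), of j i] ij ws by simp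
    qed
  qed (use W in auto)
  then have "unitary_mat n W" using W by (rule unitary_matI[rotated])
  moreover have "col W 0 = f v \<cdot>\<^sub>v v"
    using n v ws0 W Wi by (intro eq_vecI) auto
  ultimately show ?thesis by blast
qed

lemma mat_adjoint_block_diag:
  fixes A D :: "complex mat"
  assumes "A \<in> carrier_mat m m" "D \<in> carrier_mat n n"
  shows "mat_adjoint (four_block_mat A (0\<^sub>m m n) (0\<^sub>m n m) D) =
    four_block_mat (mat_adjoint A) (0\<^sub>m m n) (0\<^sub>m n m) (mat_adjoint D)"
  using assms by (intro eq_matI) auto

lemma mult_block_diag:
  fixes A D A' D' :: "complex mat"
  assumes "A \<in> carrier_mat m m" "D \<in> carrier_mat n n" "A' \<in> carrier_mat m m" "D' \<in> carrier_mat n n"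
  shows "four_block_mat A (0\<^sub>m m n) (0\<^sub>m n m) D * four_block_mat A' (0\<^sub>m m n) (0\<^sub>m n m) D' =
    four_block_mat (A * A') (0\<^sub>m m n) (0\<^sub>m n m) (D * D')"
  using assms by (subst mult_four_block_mat[of _ m m _ n _ n _ _ m _ n]) auto

lemma unitary_similar:
  assumes "unitary_mat n U" "A \<in> carrier_mat n n"
  shows "similar_mat (mat_adjoint U * A * U) A"
  unfolding similar_mat_def
  using assms unitary_matD[OF assms(1)]
  by (intro exI[of _ "mat_adjoint U"] exI[of _ U] similar_mat_witI[of _ _ n]) auto

text \<open>Induction on the list of roots: an eigenvector for the head is rotated into the first
  coordinate, and symmetry leaves a smaller Hermitian block. The diagonal follows the order of
  \<open>es\<close>, which is arbitrary, so a sorted diagonal only requires sorting the linear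
  factors.\<close>

lemma hermitian_spectral:
  assumes "hermitian_mat n A" "char_poly A = (\<Prod>e\<leftarrow>es. [:- e, 1:])"
  shows "\<exists>U. unitary_mat n U \<and> mat_adjoint U * A * U = mat_diag n (\<lambda>j. es ! j)"
  using assms
proof (induction es arbitrary: n A)
  case Nil
  then have "n = 0" using degree_monic_char_poly[of A n] by (auto simp: hermitian_mat_def)
  then show ?case using Nil
    by (intro exI[of _ "1\<^sub>m 0"] conjI)
      (auto intro!: eq_matI unitary_matI simp: hermitian_mat_def mat_diag_def)
next
  case (Cons e es)
  have A: "A \<in> carrier_mat n n" using Cons.prems by (simp add: hermitian_mat_def)
  have "eigenvalue A e"
    unfolding eigenvalue_root_char_poly[OF A] Cons.prems(2) by simp
  then obtain v where "eigenvector A v e" by (auto simp: eigenvalue_def)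
  then have v: "v \<in> carrier_vec n" "v \<noteq> 0\<^sub>v n" and Av: "A *\<^sub>v v = e \<cdot>\<^sub>v v"
    using A by (auto simp: eigenvector_def)
  then obtain m where n: "n = Suc m" by (cases n) auto
  obtain W c where W: "unitary_mat n W" and Wc: "col W 0 = c \<cdot>\<^sub>v v"
    using unitary_with_first_col[OF v] by blast
  note WD = unitary_matD[OF W]
  define M where "M = mat_adjoint W * A * W"
  have M: "hermitian_mat n M" unfolding M_def by (rule hermitian_conjugate[OF Cons.prems(1) WD(1)])
  then have Mc: "M \<in> carrier_mat n n" by (simp add: hermitian_mat_def)
  \<comment> \<open>The first column of \<open>W\<close> is a multiple of \<open>v\<close>, hence
    satisfies the same eigenvalue equation.\<close>
  have AW: "col (A * W) 0 = e \<cdot>\<^sub>v col W 0"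
  proof -
    have "col (A * W) 0 = A *\<^sub>v col W 0" using A WD(1) n by (subst col_mult2[of _ n n _ n]) auto
    also have "\<dots> = c \<cdot>\<^sub>v (A *\<^sub>v v)" unfolding Wc by (rule mult_mat_vec[OF A v(1)])
    finally show ?thesis unfolding Wc Av by (simp add: smult_smult_assoc mult.commute)
  qed
  have AWi: "(A * W) $$ (l, 0) = e * W $$ (l, 0)" if "l < n" for l
    using arg_cong[OF AW, of "\<lambda>w. w $ l"] that A WD(1) n by (auto simp del: index_mult_mat(1))
  \<comment> \<open>Orthonormality of the columns of \<open>W\<close> reduces the first column of
    \<open>M\<close> to \<open>e\<close> times the first unit vector; the first row then follows
    since \<open>M\<close> is Hermitian.\<close>
  have M0: "M $$ (i, 0) = (if i = 0 then e else 0)" if "i < n" for i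
  proof -
    have "M $$ (i, 0) = (mat_adjoint W * (A * W)) $$ (i, 0)"
      unfolding M_def using A WD by (simp add: assoc_mult_mat[of _ n n _ n _ n])
    also have "\<dots> = (\<Sum>l<n. cnj (W $$ (l, i)) * (A * W) $$ (l, 0))"
      by (rule index_adjoint_mult[of _ n n _ n]) (use A WD that n in auto)
    also have "\<dots> = e * (\<Sum>l<n. cnj (W $$ (l, i)) * W $$ (l, 0))"
      unfolding sum_distrib_left using AWi by (intro sum.cong) auto
    also have "(\<Sum>l<n. cnj (W $$ (l, i)) * W $$ (l, 0)) = (mat_adjoint W * W) $$ (i, 0)"
      by (rule index_adjoint_mult[of _ n n _ n, symmetric]) (use WD that n in auto)
    finally show ?thesis using WD(3) that n by simp
  qed
  have M0': "M $$ (0, i) = 0" if "i < n" "i \<noteq> 0" for i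
    using hermitian_index[OF M, of i 0] M0[OF that(1)] that n by auto
  define E where "E = mat 1 1 (\<lambda>_. e)"
  define M' where "M' = mat m m (\<lambda>(i, j). M $$ (Suc i, Suc j))"
  have E: "E \<in> carrier_mat 1 1" and M'c: "M' \<in> carrier_mat m m" by (auto simp: E_def M'_def)
  have block: "M = four_block_mat E (0\<^sub>m 1 m) (0\<^sub>m m 1) M'"
    using Mc n M0 M0' by (intro eq_matI) (auto simp: E_def M'_def)
  have M': "hermitian_mat m M'" unfolding hermitian_mat_def
  proof
    show "mat_adjoint M' = M'"
      using hermitian_index[OF M] n by (intro eq_matI) (auto simp: M'_def)
  qed (rule M'c)
  have "char_poly A = char_poly M"
    unfolding M_def by (rule char_poly_similar[symmetric, OF unitary_similar[OF W A]])
  also have "\<dots> = char_poly E * char_poly M'"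
    unfolding block by (rule char_poly_four_block_zeros_col[OF E _ M'c]) auto
  also have "char_poly E = [:- e, 1:]"
    by (simp add: E_def char_poly_defs det_def sign_def)
  \<comment> \<open>The common factor \<open>[:- e, 1:]\<close> is cancelled, so the remaining roots
    are exactly those of the smaller block.\<close>
  finally have "char_poly M' = (\<Prod>e\<leftarrow>es. [:- e, 1:])"
    unfolding Cons.prems(2) by (simp del: mult_pCons_left)
  from Cons.IH[OF M' this] obtain U where U: "unitary_mat m U"
    and UM: "mat_adjoint U * M' * U = mat_diag m (\<lambda>j. es ! j)" by blast
  note UD = unitary_matD[OF U]
  \<comment> \<open>The diagonalizer of the smaller block, extended by a leading 1 so that the
    eigenvalue already split off stays in place.\<close>
  define F where "F = four_block_mat (1\<^sub>m 1) (0\<^sub>m 1 m) (0\<^sub>m m 1) U"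
  have one: "mat_adjoint (1\<^sub>m 1 :: complex mat) = 1\<^sub>m 1" by (intro eq_matI) auto
  have F: "F \<in> carrier_mat n n" using UD n by (auto simp: F_def)
  have Fa: "mat_adjoint F = four_block_mat (1\<^sub>m 1) (0\<^sub>m 1 m) (0\<^sub>m m 1) (mat_adjoint U)"
    unfolding F_def by (subst mat_adjoint_block_diag) (use UD one in auto)
  have "mat_adjoint F * F = 1\<^sub>m n"
    unfolding Fa unfolding F_def by (subst mult_block_diag) (use UD n in auto)
  then have Fu: "unitary_mat n F" using F by (rule unitary_matI[rotated])
  have "mat_adjoint (W * F) * A * (W * F) = mat_adjoint F * M * F"
    unfolding M_def by (rule adjoint_mult_conjugate[OF A WD(1) F])
  also have "\<dots> = four_block_mat E (0\<^sub>m 1 m) (0\<^sub>m m 1) (mat_adjoint U * M' * U)"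
    unfolding Fa block unfolding F_def
    using UD E M'c by (simp add: mult_block_diag mult_carrier_mat[of _ m m _ m])
  also have "\<dots> = mat_diag n (\<lambda>j. (e # es) ! j)"
    unfolding UM using n by (intro eq_matI) (auto simp: E_def mat_diag_def)
  finally show ?case using unitary_mat_mult[OF W Fu] by blast
qed

section \<open>Sorted eigenvalues read off a diagonal form\<close>

lemma char_poly_mat_diag:
  "char_poly (mat_diag n c) = (\<Prod>e\<leftarrow>map c [0..<n]. [:- e, 1:])"
proof -
  have "diag_mat (mat_diag n c) = map c [0..<n]"
    by (auto simp: diag_mat_def mat_diag_def)
  moreover have "upper_triangular (mat_diag n c)" by (auto simp: mat_diag_def)
  ultimately show ?thesis using char_poly_upper_triangular[OF mat_diag_dim, of n c] by simp
qed

lemma unitary_diag_char_poly: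
  assumes "A \<in> carrier_mat n n" "unitary_mat n U" "mat_adjoint U * A * U = mat_diag n c"
  shows "char_poly A = (\<Prod>e\<leftarrow>map c [0..<n]. [:- e, 1:])"
  using char_poly_similar[OF unitary_similar[OF assms(2,1)]] char_poly_mat_diag[of n c] assms(3)
  by simp

lemma proots_prod_linear:
  fixes es :: "complex list"
  shows "proots (\<Prod>e\<leftarrow>es. [:- e, 1:]) = mset es"
proof (induction es)
  case (Cons e es)
  have "(\<Prod>e\<leftarrow>es. [:- e, 1:]) \<noteq> 0" by (auto simp: prod_list_zero_iff)
  then show ?case using Cons by (simp add: proots_mult del: mult_pCons_left)
qed simp

lemma eigvals_down_eqI:
  assumes "char_poly A = (\<Prod>e\<leftarrow>map complex_of_real rs. [:- e, 1:])" "sorted (rev rs)"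
  shows "eigvals_down A = rs"
proof -
  have "image_mset Re (proots (char_poly A)) = mset rs"
    unfolding assms(1) proots_prod_linear by (simp add: image_mset.compositionality comp_def)
  then have "eigvals_down A = rev (sort rs)" by (simp add: eigvals_down_def)
  also have "sort rs = rev rs" by (rule properties_for_sort) (use assms in auto)
  finally show ?thesis by simp
qed

lemma eigval_down_antimono:
  assumes "A \<in> carrier_mat n n" "i \<le> j" "j < n"
  shows "eigval_down A j \<le> eigval_down A i"
proof -
  have "sorted (rev (eigvals_down A))" by (simp add: eigvals_down_def)
  then show ?thesis
    using assms length_eigvals_down[OF assms(1)]
    by (auto simp: eigval_down_def sorted_rev_iff_nth_mono)
qed

text \<open>A non-increasing real diagonal must be the sorted eigenvalue list, because the
  characteristic polynomial determines the multiset of its entries. This identifies a diagonal that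
  is known only as a limit, with no separate continuity argument for eigenvalues.\<close>

lemma sorted_diagonalizesI:
  assumes A: "A \<in> carrier_mat n n" and U: "unitary_mat n U"
    and eq: "mat_adjoint U * A * U = mat_diag n (\<lambda>j. complex_of_real (f j))"
    and anti: "\<And>i j. i \<le> j \<Longrightarrow> j < n \<Longrightarrow> f j \<le> f i"
  shows "sorted_diagonalizes n U A"
proof -
  have "sorted (rev (map f [0..<n]))"
    using anti by (auto simp: sorted_rev_iff_nth_mono)
  moreover have "char_poly A = (\<Prod>e\<leftarrow>map complex_of_real (map f [0..<n]). [:- e, 1:])"
    using unitary_diag_char_poly[OF A U eq] by (simp add: comp_def)
  ultimately have "eigvals_down A = map f [0..<n]" by (rule eigvals_down_eqI[rotated])
  then have "mat_diag n (\<lambda>j. complex_of_real (eigval_down A j)) = mat_diag n (\<lambda>j. complex_of_real (f j))"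
    by (intro eq_matI) (auto simp: eigval_down_def mat_diag_def)
  then show ?thesis using U eq by (simp add: sorted_diagonalizes_def)
qed

text \<open>The spectral theorem is applied twice: first with the roots in any order, to see that
  they are real, then with the roots sorted.\<close>

lemma hermitian_sorted_diagonalizes:
  assumes A: "hermitian_mat n A"
  shows "\<exists>U. sorted_diagonalizes n U A"
proof -
  have Ac: "A \<in> carrier_mat n n" using A by (simp add: hermitian_mat_def)
  obtain as where as: "char_poly A = (\<Prod>a\<leftarrow>as. [:- a, 1:])" "length as = n"
    using char_poly_factorized[OF Ac] by blast
  obtain U where U: "unitary_mat n U" "mat_adjoint U * A * U = mat_diag n (\<lambda>j. as ! j)"
    using hermitian_spectral[OF A as(1)] by blast
  \<comment> \<open>The diagonal form is itself Hermitian, so its diagonal entries, the roots, are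
    real.\<close>
  have "hermitian_mat n (mat_diag n (\<lambda>j. as ! j))"
    using hermitian_conjugate[OF A unitary_matD(1)[OF U(1)]] U(2) by simp
  then have real: "complex_of_real (Re (as ! j)) = as ! j" if "j < n" for j
    using hermitian_diag_real[of n "mat_diag n (\<lambda>j. as ! j)" j] that by (simp add: mat_diag_def)
  define rs where "rs = rev (sort (map Re as))"
  have "map complex_of_real (map Re as) = as"
    using real as(2) by (intro nth_equalityI) auto
  then have "mset (map complex_of_real rs) = mset as"
    by (metis mset_map mset_rev mset_sort rs_def)
  then have "mset (map (\<lambda>e. [:- e, 1:]) (map complex_of_real rs)) = mset (map (\<lambda>e. [:- e, 1:]) as)"
    by (metis mset_map)
  \<comment> \<open>Permuting the linear factors does not change their product.\<close>
  then have cp: "char_poly A = (\<Prod>e\<leftarrow>map complex_of_real rs. [:- e, 1:])"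
    unfolding as(1) by (metis prod_mset_prod_list)
  obtain V where V: "unitary_mat n V"
    "mat_adjoint V * A * V = mat_diag n (\<lambda>j. map complex_of_real rs ! j)"
    using hermitian_spectral[OF A cp] by blast
  have "length rs = n" using as(2) by (simp add: rs_def)
  then have "mat_diag n (\<lambda>j. map complex_of_real rs ! j) = mat_diag n (\<lambda>j. complex_of_real (rs ! j))"
    by (intro eq_matI) (auto simp: mat_diag_def)
  moreover have "rs ! j \<le> rs ! i" if "i \<le> j" "j < n" for i j
  proof -
    have "sorted (rev rs)" by (simp add: rs_def)
    then show ?thesis using that \<open>length rs = n\<close> by (auto simp: sorted_rev_iff_nth_mono)
  qed
  ultimately have "sorted_diagonalizes n V A"
    using sorted_diagonalizesI[OF Ac V(1), of "\<lambda>j. rs ! j"] V(2) by auto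
  then show ?thesis ..
qed

subsection \<open>Ky Fan's inequality\<close>

lemma unitary_col_norm:
  assumes U: "unitary_mat n U" and j: "j < n"
  shows "(\<Sum>l<n. (cmod (U $$ (l, j)))\<^sup>2) = 1"
proof -
  have "(mat_adjoint U * U) $$ (j, j) = (\<Sum>l<n. cnj (U $$ (l, j)) * U $$ (l, j))"
    by (rule index_adjoint_mult[OF unitary_matD(1)[OF U] unitary_matD(1)[OF U] j j])
  also have "\<dots> = complex_of_real (\<Sum>l<n. (cmod (U $$ (l, j)))\<^sup>2)"
    by (simp add: complex_norm_square mult.commute del: of_real_power)
  finally have "complex_of_real (\<Sum>l<n. (cmod (U $$ (l, j)))\<^sup>2) = 1"
    using unitary_matD(3)[OF U] j by simp
  then show ?thesis by (metis of_real_eq_1_iff)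
qed

lemma unitary_row_norm:
  assumes U: "unitary_mat n U" and i: "i < n"
  shows "(\<Sum>l<n. (cmod (U $$ (i, l)))\<^sup>2) = 1"
  using unitary_col_norm[OF unitary_mat_adjoint[OF U] i] unitary_matD(1)[OF U] i by simp

lemma unitary_entry_le_1:
  assumes U: "unitary_mat n U" and "i < n" "j < n"
  shows "cmod (U $$ (i, j)) \<le> 1"
proof -
  have "(cmod (U $$ (i, j)))\<^sup>2 \<le> (\<Sum>l<n. (cmod (U $$ (l, j)))\<^sup>2)"
    using assms by (intro member_le_sum) auto
  then show ?thesis using unitary_col_norm[OF U assms(3)] by (simp add: power_le_one_iff)
qed

text \<open>After subtracting the threshold \<open>\<mu>\<close>, full weight is best on the
  nonnegative terms below index \<open>k\<close> and zero weight on the nonpositive terms from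
  \<open>k\<close> on. The total weight \<open>k\<close> makes the contributions of
  \<open>\<mu>\<close> cancel.\<close>

lemma weighted_sum_le_top_sum:
  fixes f p :: "nat \<Rightarrow> real"
  assumes anti: "\<And>i j. i \<le> j \<Longrightarrow> j < n \<Longrightarrow> f j \<le> f i"
    and p: "\<And>i. i < n \<Longrightarrow> 0 \<le> p i" "\<And>i. i < n \<Longrightarrow> p i \<le> 1"
    and total: "(\<Sum>i<n. p i) = real k" and "k \<le> n"
  shows "(\<Sum>i<n. f i * p i) \<le> (\<Sum>i<k. f i)"
proof -
  \<comment> \<open>For \<open>k = 0\<close> the truncated subtraction gives \<open>f 0\<close>,
    which still bounds all \<open>f i\<close> with \<open>i < n\<close> from above.\<close>
  define \<mu> where "\<mu> = f (k - 1)"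
  have "(\<Sum>i<n. (f i - \<mu>) * p i) \<le> (\<Sum>i<n. if i < k then f i - \<mu> else 0)"
  proof (rule sum_mono)
    fix i assume "i \<in> {..<n}"
    then have i: "i < n" by simp
    show "(f i - \<mu>) * p i \<le> (if i < k then f i - \<mu> else 0)"
    proof (cases "i < k")
      case True
      then have "f i - \<mu> \<ge> 0" using anti[of i "k - 1"] \<open>k \<le> n\<close> by (simp add: \<mu>_def)
      then show ?thesis using True p(2)[OF i] by (simp add: mult_left_le)
    next
      case False
      then have "f i - \<mu> \<le> 0" using anti[of "k - 1" i] i by (simp add: \<mu>_def)
      then show ?thesis using False p(1)[OF i] by (simp add: mult_nonpos_nonneg)
    qed
  qed
  also have "\<dots> = (\<Sum>i<k. f i - \<mu>)"
    using \<open>k \<le> n\<close> by (intro sum.mono_neutral_cong_right) auto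
  finally show ?thesis
    using total by (simp add: left_diff_distrib sum_subtractf flip: sum_distrib_left)
qed

text \<open>At \<open>mat_adjoint G * X * G\<close> this is the sum of the quadratic forms of
  \<open>X\<close> on the first \<open>k\<close> columns of \<open>G\<close>, the functional
  maximized in Ky Fan's principle.\<close>

definition lead_trace :: "nat \<Rightarrow> complex mat \<Rightarrow> real" where
  "lead_trace k X = (\<Sum>j<k. Re (X $$ (j, j)))"

lemma lead_trace_sorted_diagonalizes:
  assumes "sorted_diagonalizes n U A" "k \<le> n"
  shows "lead_trace k (mat_adjoint U * A * U) = (\<Sum>j<k. eigval_down A j)"
  using assms by (auto simp: sorted_diagonalizes_def lead_trace_def mat_diag_def intro!: sum.cong)

lemma lead_trace_conj_add_smult:
  assumes "A \<in> carrier_mat n n" "B \<in> carrier_mat n n" "G \<in> carrier_mat n n" "k \<le> n"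
  shows "lead_trace k (mat_adjoint G * (A + complex_of_real t \<cdot>\<^sub>m B) * G) =
    lead_trace k (mat_adjoint G * A * G) + t * lead_trace k (mat_adjoint G * B * G)"
proof -
  have "mat_adjoint G * (A + complex_of_real t \<cdot>\<^sub>m B) * G =
    mat_adjoint G * A * G + complex_of_real t \<cdot>\<^sub>m (mat_adjoint G * B * G)"
  proof -
    have c: "mat_adjoint G * A \<in> carrier_mat n n" "mat_adjoint G * B \<in> carrier_mat n n"
      using assms by (auto intro!: mult_carrier_mat[of _ n n _ n])
    have "mat_adjoint G * (A + complex_of_real t \<cdot>\<^sub>m B) =
      mat_adjoint G * A + complex_of_real t \<cdot>\<^sub>m (mat_adjoint G * B)"
      using assms by (subst mult_add_distrib_mat[of _ n n _ n]) (auto simp: mult_smult_distrib[of _ n n _ n])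
    then show ?thesis
      using assms c by (simp add: add_mult_distrib_mat[of _ n n _ _ n] mult_smult_assoc_mat[of _ n n _ n])
  qed
  moreover have "mat_adjoint G * B * G \<in> carrier_mat n n" "mat_adjoint G * A * G \<in> carrier_mat n n"
    using assms by (auto intro!: mult_carrier_mat[of _ n n _ n])
  ultimately show ?thesis
    using assms(4) unfolding lead_trace_def sum_distrib_left sum.distrib[symmetric]
    by (intro sum.cong) (auto simp del: index_mult_mat(1))
qed

text \<open>In an eigenbasis of \<open>A\<close>, the diagonal entries of the conjugated matrix are
  averages of eigenvalues with weights \<open>w l j\<close>, the squared moduli of the entries of a
  unitary matrix. These weights are doubly stochastic, so the eigenvalue \<open>l\<close> receives
  weight at most 1 from the first \<open>k\<close> columns, and the total weight is
  \<open>k\<close>.\<close>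

lemma ky_fan:
  assumes A: "hermitian_mat n A" and G: "unitary_mat n G" and k: "k \<le> n"
  shows "lead_trace k (mat_adjoint G * A * G) \<le> (\<Sum>j<k. eigval_down A j)"
proof -
  have Ac: "A \<in> carrier_mat n n" using A by (simp add: hermitian_mat_def)
  obtain U where sd: "sorted_diagonalizes n U A" using hermitian_sorted_diagonalizes[OF A] by blast
  define D where "D = mat_diag n (\<lambda>j. complex_of_real (eigval_down A j))"
  have U: "unitary_mat n U" and UA: "mat_adjoint U * A * U = D"
    using sd by (auto simp: sorted_diagonalizes_def D_def)
  \<comment> \<open>The columns of \<open>W\<close> are the coordinates of the columns of
    \<open>G\<close> in the eigenbasis \<open>U\<close>.\<close>
  define W where "W = mat_adjoint U * G"
  have W: "unitary_mat n W"
    unfolding W_def by (intro unitary_mat_mult unitary_mat_adjoint U G)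
  note c = unitary_matD[OF U] unitary_matD[OF G] unitary_matD[OF W]
  have "U * W = G" unfolding W_def using c by (simp flip: assoc_mult_mat[of _ n n _ n _ n])
  then have eq: "mat_adjoint G * A * G = mat_adjoint W * (D * W)"
    using adjoint_mult_conjugate[OF Ac c(1) c(9)] UA c
    by (simp add: assoc_mult_mat[of _ n n _ n _ n] D_def)
  have DW: "D * W = mat n n (\<lambda>(i, j). complex_of_real (eigval_down A i) * W $$ (i, j))"
    unfolding D_def by (rule mat_diag_mult_left[OF c(9)])
  define w where "w l j = (cmod (W $$ (l, j)))\<^sup>2" for l j
  have diag: "Re ((mat_adjoint G * A * G) $$ (j, j)) = (\<Sum>l<n. eigval_down A l * w l j)" if "j < n" for j
  proof -
    have "(mat_adjoint G * A * G) $$ (j, j) = (\<Sum>l<n. cnj (W $$ (l, j)) * (D * W) $$ (l, j))"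
      unfolding eq by (rule index_adjoint_mult[of _ n n _ n]) (use c that in \<open>auto simp: D_def intro!: mult_carrier_mat[of _ n n _ n]\<close>)
    also have "\<dots> = (\<Sum>l<n. complex_of_real (eigval_down A l * w l j))"
      unfolding DW using that
      by (intro sum.cong) (simp_all add: complex_norm_square w_def mult.commute mult.left_commute del: of_real_power)
    finally show ?thesis by (simp flip: of_real_sum)
  qed
  have "lead_trace k (mat_adjoint G * A * G) = (\<Sum>j<k. \<Sum>l<n. eigval_down A l * w l j)"
    unfolding lead_trace_def using diag k by (intro sum.cong) auto
  also have "\<dots> = (\<Sum>l<n. eigval_down A l * (\<Sum>j<k. w l j))"
    by (subst sum.swap) (simp add: sum_distrib_left)
  also have "\<dots> \<le> (\<Sum>l<k. eigval_down A l)"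
  proof (rule weighted_sum_le_top_sum[OF _ _ _ _ k])
    fix l assume l: "l < n"
    show "0 \<le> (\<Sum>j<k. w l j)" by (simp add: w_def sum_nonneg)
    have "(\<Sum>j<k. w l j) \<le> (\<Sum>j<n. w l j)" using k by (intro sum_mono2) (auto simp: w_def)
    then show "(\<Sum>j<k. w l j) \<le> 1" using unitary_row_norm[OF W l] by (simp add: w_def)
  next
    have "(\<Sum>l<n. \<Sum>j<k. w l j) = (\<Sum>j<k. \<Sum>l<n. w l j)" by (rule sum.swap)
    also have "\<dots> = (\<Sum>j<k. 1)"
      using unitary_col_norm[OF W] k by (intro sum.cong) (auto simp: w_def)
    finally show "(\<Sum>l<n. \<Sum>j<k. w l j) = real k" by simp
  qed (rule eigval_down_antimono[OF Ac])
  finally show ?thesis .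
qed

subsection \<open>Limit points of diagonalizing unitary matrices\<close>

text \<open>Bolzano-Weierstrass one coordinate at a time: each further extraction preserves the
  limits already obtained.\<close>

lemma bounded_family_convergent_subseq:
  fixes x :: "nat \<Rightarrow> 'a \<Rightarrow> complex"
  assumes "finite S" "\<And>m i. i \<in> S \<Longrightarrow> cmod (x m i) \<le> r"
  shows "\<exists>\<phi> l. strict_mono \<phi> \<and> (\<forall>i\<in>S. (\<lambda>m. x (\<phi> m) i) \<longlonglongrightarrow> l i)"
  using assms
proof (induction S rule: finite_induct)
  case empty
  then show ?case by (intro exI[of _ id]) (auto simp: strict_mono_def)
next
  case (insert a S)
  obtain \<phi> l where \<phi>: "strict_mono \<phi>" and l: "\<And>i. i \<in> S \<Longrightarrow> (\<lambda>m. x (\<phi> m) i) \<longlonglongrightarrow> l i"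
    using insert.IH insert.prems by (metis insertCI)
  have "\<forall>m. cmod (x (\<phi> m) a) \<le> r" using insert.prems by simp
  from Bolzano_Weierstrass_complex_disc[OF this]
  obtain \<psi> :: "nat \<Rightarrow> nat" and z where \<psi>: "strict_mono \<psi>" "\<forall>e>0. \<exists>N. \<forall>n\<ge>N. cmod (x (\<phi> (\<psi> n)) a - z) < e" by blast
  have "(\<lambda>m. x (\<phi> (\<psi> m)) a) \<longlonglongrightarrow> z" using \<psi>(2) by (simp add: LIMSEQ_def dist_norm)
  moreover have "(\<lambda>m. x (\<phi> (\<psi> m)) i) \<longlonglongrightarrow> l i" if "i \<in> S" for i
    using LIMSEQ_subseq_LIMSEQ[OF l[OF that] \<psi>(1)] by (simp add: comp_def)
  moreover have "strict_mono (\<phi> \<circ> \<psi>)" using \<phi> \<psi>(1) by (rule strict_mono_o)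
  ultimately show ?case
    using insert.hyps(2)
    by (intro exI[of _ "\<phi> \<circ> \<psi>"] exI[of _ "l(a := z)"]) (auto simp: comp_def)
qed

text \<open>Entrywise convergence in a fixed dimension; including the carrier conditions lets
  products and adjoints pass to the limit without further side conditions.\<close>

definition mat_tendsto :: "nat \<Rightarrow> (nat \<Rightarrow> complex mat) \<Rightarrow> complex mat \<Rightarrow> bool" where
  "mat_tendsto n X Y \<longleftrightarrow> (\<forall>m. X m \<in> carrier_mat n n) \<and> Y \<in> carrier_mat n n \<and>
     (\<forall>i<n. \<forall>j<n. (\<lambda>m. X m $$ (i, j)) \<longlonglongrightarrow> Y $$ (i, j))"

lemma mat_tendsto_index:
  "mat_tendsto n X Y \<Longrightarrow> i < n \<Longrightarrow> j < n \<Longrightarrow> (\<lambda>m. X m $$ (i, j)) \<longlonglongrightarrow> Y $$ (i, j)"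
  by (simp add: mat_tendsto_def)

lemma mat_tendsto_const: "A \<in> carrier_mat n n \<Longrightarrow> mat_tendsto n (\<lambda>_. A) A"
  by (simp add: mat_tendsto_def)

lemma mat_tendsto_mult:
  assumes "mat_tendsto n X Y" "mat_tendsto n X' Y'"
  shows "mat_tendsto n (\<lambda>m. X m * X' m) (Y * Y')"
proof -
  have c: "X m \<in> carrier_mat n n" "X' m \<in> carrier_mat n n" "Y \<in> carrier_mat n n" "Y' \<in> carrier_mat n n" for m
    using assms by (auto simp: mat_tendsto_def)
  show ?thesis unfolding mat_tendsto_def
  proof (intro conjI allI impI)
    fix i j assume ij: "i < n" "j < n"
    show "(\<lambda>m. (X m * X' m) $$ (i, j)) \<longlonglongrightarrow> (Y * Y') $$ (i, j)"
      unfolding index_mult_mat_sum[OF c(1,2) ij] index_mult_mat_sum[OF c(3,4) ij]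
      by (intro tendsto_intros mat_tendsto_index[OF assms(1)] mat_tendsto_index[OF assms(2)] ij) auto
  qed (use c in \<open>auto intro!: mult_carrier_mat[of _ n n _ n]\<close>)
qed

lemma mat_tendsto_adjoint:
  assumes "mat_tendsto n X Y"
  shows "mat_tendsto n (\<lambda>m. mat_adjoint (X m)) (mat_adjoint Y)"
proof -
  have c: "X m \<in> carrier_mat n n" "Y \<in> carrier_mat n n" for m
    using assms by (auto simp: mat_tendsto_def)
  have "(\<lambda>m. mat_adjoint (X m) $$ (i, j)) \<longlonglongrightarrow> mat_adjoint Y $$ (i, j)" if "i < n" "j < n" for i j
    using tendsto_cnj[OF mat_tendsto_index[OF assms that(2,1)]] that c[THEN carrier_matD(1)] c[THEN carrier_matD(2)]
    by simp
  then show ?thesis using c unfolding mat_tendsto_def by (blast intro: mat_adjoint_carrier)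
qed

lemma mat_tendsto_add_smult:
  assumes "A \<in> carrier_mat n n" "B \<in> carrier_mat n n" "t \<longlonglongrightarrow> 0"
  shows "mat_tendsto n (\<lambda>m. A + complex_of_real (t m) \<cdot>\<^sub>m B) A"
  unfolding mat_tendsto_def
proof (intro conjI allI impI)
  fix i j assume ij: "i < n" "j < n"
  have "(\<lambda>m. A $$ (i, j) + complex_of_real (t m) * B $$ (i, j)) \<longlonglongrightarrow> A $$ (i, j) + complex_of_real 0 * B $$ (i, j)"
    by (intro tendsto_intros assms)
  then show "(\<lambda>m. (A + complex_of_real (t m) \<cdot>\<^sub>m B) $$ (i, j)) \<longlonglongrightarrow> A $$ (i, j)"
    using assms ij by simp
qed (use assms in auto)

text \<open>Unitary matrices have entries bounded by 1, so a subsequence converges. Unitarity,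
  vanishing off-diagonal entries, realness and the order of the diagonal are all closed conditions
  and survive in the limit.\<close>

lemma sorted_diagonalizes_subseq:
  assumes X: "mat_tendsto n X A" and G: "\<And>m. sorted_diagonalizes n (G m) (X m)"
  shows "\<exists>\<phi> U. strict_mono \<phi> \<and> mat_tendsto n (\<lambda>m. G (\<phi> m)) U \<and> sorted_diagonalizes n U A"
proof -
  have Gu: "unitary_mat n (G m)"
    and GX: "mat_adjoint (G m) * X m * G m = mat_diag n (\<lambda>j. complex_of_real (eigval_down (X m) j))" for m
    using G by (auto simp: sorted_diagonalizes_def)
  note Gc = unitary_matD[OF Gu]
  have Xc: "X m \<in> carrier_mat n n" and Ac: "A \<in> carrier_mat n n" for m
    using X by (auto simp: mat_tendsto_def)
  have "\<exists>\<phi> l. strict_mono \<phi> \<and> (\<forall>ij\<in>{..<n} \<times> {..<n}. (\<lambda>m. G (\<phi> m) $$ ij) \<longlonglongrightarrow> l ij)"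
    by (rule bounded_family_convergent_subseq[where r = 1]) (auto intro: unitary_entry_le_1[OF Gu])
  then obtain \<phi> l where \<phi>: "strict_mono \<phi>"
    and l: "\<And>ij. ij \<in> {..<n} \<times> {..<n} \<Longrightarrow> (\<lambda>m. G (\<phi> m) $$ ij) \<longlonglongrightarrow> l ij" by blast
  define U where "U = mat n n l"
  have U: "U \<in> carrier_mat n n" by (simp add: U_def)
  have GU: "mat_tendsto n (\<lambda>m. G (\<phi> m)) U"
    using Gc U l by (auto simp: mat_tendsto_def U_def)
  have X\<phi>: "mat_tendsto n (\<lambda>m. X (\<phi> m)) A"
    unfolding mat_tendsto_def
  proof (intro conjI allI impI)
    fix i j assume "i < n" "j < n"
    from LIMSEQ_subseq_LIMSEQ[OF mat_tendsto_index[OF X this] \<phi>]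
    show "(\<lambda>m. X (\<phi> m) $$ (i, j)) \<longlonglongrightarrow> A $$ (i, j)" by (simp add: comp_def)
  qed (use Xc Ac in auto)
  have "mat_tendsto n (\<lambda>m. mat_adjoint (G (\<phi> m)) * G (\<phi> m)) (mat_adjoint U * U)"
    by (intro mat_tendsto_mult mat_tendsto_adjoint GU)
  then have "(\<lambda>m. 1\<^sub>m n $$ (i, j)) \<longlonglongrightarrow> (mat_adjoint U * U) $$ (i, j)" if "i < n" "j < n" for i j
    using mat_tendsto_index[OF _ that] Gc(3) by force
  then have "mat_adjoint U * U = 1\<^sub>m n"
    using U by (intro eq_matI) (auto simp: tendsto_const_iff simp del: index_mult_mat(1))
  with U have Uu: "unitary_mat n U" by (rule unitary_matI)
  define D where "D = mat_adjoint U * A * U"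
  have D: "D \<in> carrier_mat n n" using U Ac by (auto simp: D_def intro!: mult_carrier_mat[of _ n n _ n])
  have "mat_tendsto n (\<lambda>m. mat_adjoint (G (\<phi> m)) * X (\<phi> m) * G (\<phi> m)) D"
    unfolding D_def by (intro mat_tendsto_mult mat_tendsto_adjoint GU X\<phi>)
  then have lim: "(\<lambda>m. mat_diag n (\<lambda>j. complex_of_real (eigval_down (X (\<phi> m)) j)) $$ (i, j)) \<longlonglongrightarrow> D $$ (i, j)"
    if "i < n" "j < n" for i j
    using mat_tendsto_index[OF _ that] GX by force
  \<comment> \<open>Off the diagonal the converging sequence is constantly 0.\<close>
  have off: "D $$ (i, j) = 0" if "i < n" "j < n" "i \<noteq> j" for i j
    using lim[OF that(1,2)] that by (simp add: mat_diag_def LIMSEQ_const_iff)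
  have diag: "(\<lambda>m. complex_of_real (eigval_down (X (\<phi> m)) j)) \<longlonglongrightarrow> D $$ (j, j)" if "j < n" for j
    using lim[OF that that] that by (simp add: mat_diag_def)
  have "Im (D $$ (j, j)) = 0" if "j < n" for j
    using tendsto_Im[OF diag[OF that]] by (simp add: LIMSEQ_const_iff)
  then have "D = mat_diag n (\<lambda>j. complex_of_real (Re (D $$ (j, j))))"
    using D off by (intro eq_matI) (auto simp: mat_diag_def complex_eq_iff)
  moreover have "Re (D $$ (j, j)) \<le> Re (D $$ (i, i))" if "i \<le> j" "j < n" for i j
  proof (rule LIMSEQ_le)
    show "(\<lambda>m. eigval_down (X (\<phi> m)) j) \<longlonglongrightarrow> Re (D $$ (j, j))"
      using tendsto_Re[OF diag[OF that(2)]] by simp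
    show "(\<lambda>m. eigval_down (X (\<phi> m)) i) \<longlonglongrightarrow> Re (D $$ (i, i))"
      using tendsto_Re[OF diag[of i]] that by simp
    show "\<exists>N. \<forall>m\<ge>N. eigval_down (X (\<phi> m)) j \<le> eigval_down (X (\<phi> m)) i"
      using eigval_down_antimono[OF Xc that] by blast
  qed
  \<comment> \<open>The limiting diagonal is real and non-increasing, which already forces it to
    consist of the sorted eigenvalues of \<open>A\<close>.\<close>
  ultimately have "sorted_diagonalizes n U A"
    unfolding D_def by (intro sorted_diagonalizesI[OF Ac Uu])
  then show ?thesis using \<phi> GU by blast
qed

subsection \<open>Directional derivatives of eigenvalue sums\<close>

lemma hermitian_add_smult:
  assumes "hermitian_mat n A" "hermitian_mat n B"
  shows "hermitian_mat n (A + complex_of_real t \<cdot>\<^sub>m B)"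
  unfolding hermitian_mat_def
proof
  have c: "A \<in> carrier_mat n n" "B \<in> carrier_mat n n" using assms by (auto simp: hermitian_mat_def)
  show "mat_adjoint (A + complex_of_real t \<cdot>\<^sub>m B) = A + complex_of_real t \<cdot>\<^sub>m B"
    using c by (intro eq_matI) (auto simp: hermitian_index[OF assms(1)] hermitian_index[OF assms(2)])
qed (use assms in \<open>auto simp: hermitian_mat_def\<close>)

text \<open>\<open>U\<close> is chosen before \<open>k\<close>, so a single basis serves all partial
  sums. The argument also proves that the one-sided limits exist.\<close>

lemma is_delta_exists_diagonalizer:
  assumes A: "hermitian_mat n A" and B: "hermitian_mat n B"
  shows "\<exists>U. sorted_diagonalizes n U A \<and>
    is_delta B A (vec n (\<lambda>j. Re ((mat_adjoint U * B * U) $$ (j, j))))"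
proof -
  have Ac: "A \<in> carrier_mat n n" and Bc: "B \<in> carrier_mat n n" using A B by (auto simp: hermitian_mat_def)
  define X where "X t = A + complex_of_real t \<cdot>\<^sub>m B" for t
  have X: "hermitian_mat n (X t)" for t unfolding X_def by (rule hermitian_add_smult[OF A B])
  \<comment> \<open>Any positive null sequence would do; it serves only to extract \<open>U\<close>,
    while the limit below is over all \<open>t\<close> from the right.\<close>
  define \<tau> where "\<tau> m = inverse (real (Suc m))" for m
  have \<tau>: "\<tau> m > 0" "\<tau> \<longlonglongrightarrow> 0" for m
    using LIMSEQ_inverse_real_of_nat by (auto simp: \<tau>_def[abs_def])
  have "\<forall>t. \<exists>G. sorted_diagonalizes n G (X t)" using hermitian_sorted_diagonalizes[OF X] by blast
  then obtain G where G: "\<And>t. sorted_diagonalizes n (G t) (X t)" by metis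
  have Gu: "unitary_mat n (G t)" for t using G by (simp add: sorted_diagonalizes_def)
  have "mat_tendsto n (\<lambda>m. X (\<tau> m)) A"
    unfolding X_def by (rule mat_tendsto_add_smult[OF Ac Bc \<tau>(2)])
  from sorted_diagonalizes_subseq[OF this, of "\<lambda>m. G (\<tau> m)"] G
  obtain \<phi> U where \<phi>: "strict_mono \<phi>" and lim: "mat_tendsto n (\<lambda>m. G (\<tau> (\<phi> m))) U"
    and U: "sorted_diagonalizes n U A" by blast
  have Uu: "unitary_mat n U" using U by (simp add: sorted_diagonalizes_def)
  define s where "s k Y = (\<Sum>j<k. eigval_down Y j)" for k Y
  define q where "q k t = (s k (X t) - s k A) / t" for k t
  define b where "b k V = lead_trace k (mat_adjoint V * B * V)" for k V
  have lead: "lead_trace k (mat_adjoint V * X t * V) = lead_trace k (mat_adjoint V * A * V) + t * b k V"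
    if "k \<le> n" "unitary_mat n V" for k V t
    unfolding X_def b_def by (rule lead_trace_conj_add_smult[OF Ac Bc unitary_matD(1)[OF that(2)] that(1)])
  have sX: "s k (X t) = lead_trace k (mat_adjoint (G t) * A * G t) + t * b k (G t)" if "k \<le> n" for k t
    using lead_trace_sorted_diagonalizes[OF G that] lead[OF that Gu] by (simp add: s_def)
  \<comment> \<open>\<open>U\<close> attains the maximum at \<open>A\<close> and is a competitor at
    \<open>X t\<close>.\<close>
  have lower: "b k U \<le> q k t" if "k \<le> n" "t > 0" for k t
  proof -
    have "s k A + t * b k U \<le> s k (X t)"
      using ky_fan[OF X Uu that(1), of t] lead[OF that(1) Uu, of t]
        lead_trace_sorted_diagonalizes[OF U that(1)] by (simp add: s_def)
    then show ?thesis using that(2) by (simp add: q_def field_simps)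
  qed
  \<comment> \<open>With \<open>G t\<close> fixed, the leading trace is affine in the parameter. It
    is at most \<open>s k A\<close> at 0 and at most \<open>s k A + u * b k (G u)\<close> at
    \<open>u\<close>; interpolation at \<open>t\<close>, where it equals \<open>s k (X t)\<close>,
    gives the bound.\<close>
  have upper: "q k t \<le> b k (G u)" if "k \<le> n" "0 < t" "t \<le> u" for k t u
  proof -
    have fan: "lead_trace k (mat_adjoint (G v) * A * G v) \<le> s k A" for v
      unfolding s_def by (rule ky_fan[OF A Gu that(1)])
    define a where "a = lead_trace k (mat_adjoint (G t) * A * G t)"
    have "a + u * b k (G t) \<le> s k (X u)"
      using ky_fan[OF X Gu[of t] that(1), of u] lead[OF that(1) Gu[of t], of u] by (simp add: s_def a_def)
    also have "\<dots> \<le> s k A + u * b k (G u)"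
      using fan[of u] sX[OF that(1), of u] by simp
    \<comment> \<open>The weights \<open>t\<close> at \<open>u\<close> and \<open>u - t\<close> at 0
      give the convex combination, cleared of the denominator \<open>u\<close>.\<close>
    finally have "t * (a + u * b k (G t)) \<le> t * (s k A + u * b k (G u))"
      using that by (intro mult_left_mono) auto
    moreover have "(u - t) * a \<le> (u - t) * s k A"
      using fan[of t] that by (intro mult_left_mono) (auto simp: a_def)
    ultimately have "u * (a + t * b k (G t)) \<le> u * (s k A + t * b k (G u))"
      by (simp add: algebra_simps)
    then have "s k (X t) \<le> s k A + t * b k (G u)"
      using that sX[OF that(1), of t] by (simp add: a_def)
    then show ?thesis using that(2) by (simp add: q_def field_simps)
  qed
  have blim: "(\<lambda>m. b k (G (\<tau> (\<phi> m)))) \<longlonglongrightarrow> b k U" if "k \<le> n" for k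
  proof -
    have "mat_tendsto n (\<lambda>m. mat_adjoint (G (\<tau> (\<phi> m))) * B * G (\<tau> (\<phi> m))) (mat_adjoint U * B * U)"
      by (intro mat_tendsto_mult mat_tendsto_adjoint mat_tendsto_const lim Bc)
    then show ?thesis
      unfolding b_def lead_trace_def using that by (intro tendsto_sum tendsto_Re mat_tendsto_index[of n]) auto
  qed
  \<comment> \<open>The bound from below holds for every positive \<open>t\<close>. From above, a
    single index \<open>m\<close> with a small enough value controls the whole interval up to
    \<open>\<tau> (\<phi> m)\<close>, so convergence along the subsequence suffices.\<close>
  have qlim: "(q k \<longlongrightarrow> b k U) (at_right 0)" if k: "k \<le> n" for k
  proof (rule order_tendstoI)
    fix a assume a: "a < b k U"
    have "a < q k t" if "t > 0" for t using lower[OF k that] a by simp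
    then show "eventually (\<lambda>t. a < q k t) (at_right 0)"
      by (auto simp: eventually_at_right_field intro: exI[of _ 1])
  next
    fix a assume "b k U < a"
    then have "eventually (\<lambda>m. b k (G (\<tau> (\<phi> m))) < a) sequentially"
      by (rule order_tendstoD(2)[OF blim[OF k]])
    then obtain m where "b k (G (\<tau> (\<phi> m))) < a" by (auto simp: eventually_sequentially)
    then have "q k t < a" if "0 < t" "t < \<tau> (\<phi> m)" for t
      using upper[OF k that(1), of "\<tau> (\<phi> m)"] that(2) by simp
    then show "eventually (\<lambda>t. q k t < a) (at_right 0)"
      unfolding eventually_at_right_field using \<tau>(1)[of "\<phi> m"] by blast
  qed
  have "is_delta B A (vec n (\<lambda>j. Re ((mat_adjoint U * B * U) $$ (j, j))))"
    unfolding is_delta_def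
  proof (intro conjI ballI)
    fix k assume "k \<in> {1..dim_row A}"
    then have k: "k \<le> n" using Ac by simp
    have "(\<Sum>j<k. vec n (\<lambda>j. Re ((mat_adjoint U * B * U) $$ (j, j))) $ j) = b k U"
      unfolding b_def lead_trace_def using k by (intro sum.cong) (auto simp del: index_mult_mat(1))
    moreover have "q k = (\<lambda>t. 1 / t * (\<Sum>j<k. eigval_down (A + complex_of_real t \<cdot>\<^sub>m B) j - eigval_down A j))"
      by (auto simp: q_def s_def X_def sum_subtractf)
    ultimately show "((\<lambda>t. 1 / t * (\<Sum>j<k. eigval_down (A + complex_of_real t \<cdot>\<^sub>m B) j - eigval_down A j))
        \<longlongrightarrow> (\<Sum>j<k. vec n (\<lambda>j. Re ((mat_adjoint U * B * U) $$ (j, j))) $ j)) (at_right 0)"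
      using qlim[OF k] by simp
  qed (use Ac in auto)
  with U show ?thesis by blast
qed

text \<open>Uniqueness identifies \<open>delta\<close> with the vector just found, and
  \<open>Re\<close> disappears because the conjugate of \<open>B\<close> is Hermitian.\<close>

lemma delta_diag_exists:
  assumes A: "hermitian_mat n A" and B: "hermitian_mat n B"
  shows "\<exists>U. sorted_diagonalizes n U A \<and>
    (\<forall>j<n. complex_of_real (delta B A $ j) = (mat_adjoint U * B * U) $$ (j, j))"
proof -
  obtain U where U: "sorted_diagonalizes n U A"
    and d: "is_delta B A (vec n (\<lambda>j. Re ((mat_adjoint U * B * U) $$ (j, j))))"
    using is_delta_exists_diagonalizer[OF A B] by blast
  have "hermitian_mat n (mat_adjoint U * B * U)"
    using U by (intro hermitian_conjugate[OF B] unitary_matD(1)) (simp add: sorted_diagonalizes_def)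
  from hermitian_diag_real[OF this] show ?thesis
    using U delta_eqI[OF d] by (intro exI[of _ U]) (simp del: index_mult_mat(1))
qed

subsection \<open>Simple spectrum\<close>

text \<open>Multiplying by \<open>U\<close> or its adjoint turns the diagonal form into
  \<open>A * U = U * D\<close>, which is the eigenvalue equation read column by column.\<close>

lemma sorted_diagonalizes_iff_eigenbasis:
  assumes A: "A \<in> carrier_mat n n"
  shows "sorted_diagonalizes n U A \<longleftrightarrow> sorted_eigenbasis n U A"
proof (cases "unitary_mat n U")
  case True
  note U = unitary_matD[OF True]
  define D where "D = mat_diag n (\<lambda>j. complex_of_real (eigval_down A j))"
  have D: "D \<in> carrier_mat n n" by (simp add: D_def)
  have UD: "U * D = mat n n (\<lambda>(i, j). U $$ (i, j) * complex_of_real (eigval_down A j))"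
    unfolding D_def by (rule mat_diag_mult_right[OF U(1)])
  have AU: "A * U \<in> carrier_mat n n" using A U by auto
  \<comment> \<open>Eigenvectors must be nonzero, which holds here because columns of a unitary
    matrix have norm 1.\<close>
  have nonzero: "col U j \<noteq> 0\<^sub>v n" if "j < n" for j
  proof
    assume z: "col U j = 0\<^sub>v n"
    have "U $$ (l, j) = 0" if "l < n" for l
      using arg_cong[OF z, of "\<lambda>w. w $ l"] that \<open>j < n\<close> U(1) by simp
    then show False using unitary_col_norm[OF True that] by simp
  qed
  have "mat_adjoint U * A * U = D \<longleftrightarrow> A * U = U * D"
  proof
    assume eq: "mat_adjoint U * A * U = D"
    have "A * U = (U * mat_adjoint U) * (A * U)"
      unfolding U(4) by (rule left_mult_one_mat[OF AU, symmetric])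
    also have "\<dots> = U * (mat_adjoint U * (A * U))" by (rule assoc_mult_mat[OF U(1,2) AU])
    also have "mat_adjoint U * (A * U) = mat_adjoint U * A * U"
      by (rule assoc_mult_mat[OF U(2) A U(1), symmetric])
    finally show "A * U = U * D" unfolding eq .
  next
    assume eq: "A * U = U * D"
    have "mat_adjoint U * A * U = mat_adjoint U * (U * D)"
      using U A eq by (simp add: assoc_mult_mat[of _ n n _ n _ n])
    also have "\<dots> = D" using U D by (simp flip: assoc_mult_mat[of _ n n _ n _ n])
    finally show "mat_adjoint U * A * U = D" .
  qed
  also have "\<dots> \<longleftrightarrow> (\<forall>j<n. A *\<^sub>v col U j = complex_of_real (eigval_down A j) \<cdot>\<^sub>v col U j)"
  proof -
    have "col (A * U) j = A *\<^sub>v col U j" if "j < n" for j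
      using A U that by (intro col_mult2[of _ n n _ n]) auto
    moreover have "col (U * D) j = complex_of_real (eigval_down A j) \<cdot>\<^sub>v col U j" if "j < n" for j
      unfolding UD using U that by (intro eq_vecI) auto
    ultimately show ?thesis
      using mat_col_eqI[of "U * D" "A * U"] mult_carrier_mat[OF U(1) D] AU
      by (metis carrier_matD)
  qed
  also have "\<dots> \<longleftrightarrow> sorted_eigenbasis n U A"
    using True nonzero U(1) A by (auto simp: sorted_eigenbasis_def eigenvector_def)
  finally show ?thesis
    unfolding sorted_diagonalizes_def D_def using True by blast
qed (auto simp: sorted_diagonalizes_def sorted_eigenbasis_def)

text \<open>The number of occurrences of a root in the list \<open>es\<close> is its order in the
  characteristic polynomial, so simple roots make the list distinct.\<close>

lemma simple_spectrum_inj: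
  assumes A: "hermitian_mat n A" and simple: "simple_spectrum A"
  shows "inj_on (eigval_down A) {..<n}"
proof -
  have Ac: "A \<in> carrier_mat n n" using A by (simp add: hermitian_mat_def)
  obtain U where U: "sorted_diagonalizes n U A" using hermitian_sorted_diagonalizes[OF A] by blast
  define es where "es = map (\<lambda>j. complex_of_real (eigval_down A j)) [0..<n]"
  have cp: "char_poly A = (\<Prod>e\<leftarrow>es. [:- e, 1:])"
    unfolding es_def using U by (intro unitary_diag_char_poly[OF Ac, of U]) (auto simp: sorted_diagonalizes_def)
  have cp0: "char_poly A \<noteq> 0" using degree_monic_char_poly[OF Ac] by auto
  have "count (mset es) x = (if x \<in> set es then 1 else 0)" for x
  proof (cases "x \<in> set es")
    case True
    have "count (mset es) x = Polynomial.order x (char_poly A)"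
      using cp0 proots_prod_linear[of es] unfolding cp by (metis count_proots)
    moreover have "poly (char_poly A) x = 0"
      using True unfolding cp by (auto simp: poly_prod_list prod_list_zero_iff)
    ultimately show ?thesis
      using True simple eigenvalue_root_char_poly[OF Ac] by (simp add: simple_spectrum_def)
  qed (simp add: count_mset_0_iff)
  then have "distinct es" by (simp add: distinct_count_atmost_1)
  then show ?thesis by (auto simp: es_def distinct_map inj_on_def)
qed

text \<open>The change of basis \<open>W\<close> commutes with a diagonal matrix with distinct
  entries, hence is diagonal; being unitary, it has diagonal entries of modulus 1, which are the
  phases.\<close>

lemma sorted_eigenbasis_unique:
  assumes A: "hermitian_mat n A" and simple: "simple_spectrum A"
    and U: "sorted_eigenbasis n U A" and V: "sorted_eigenbasis n V A" and j: "j < n"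
  shows "\<exists>c. cmod c = 1 \<and> col V j = c \<cdot>\<^sub>v col U j"
proof -
  have Ac: "A \<in> carrier_mat n n" using A by (simp add: hermitian_mat_def)
  define D where "D = mat_diag n (\<lambda>j. complex_of_real (eigval_down A j))"
  have Uu: "unitary_mat n U" and Vu: "unitary_mat n V"
    and UA: "mat_adjoint U * A * U = D" and VA: "mat_adjoint V * A * V = D"
    using U V by (auto simp: sorted_diagonalizes_iff_eigenbasis[OF Ac, symmetric] sorted_diagonalizes_def D_def)
  define W where "W = mat_adjoint U * V"
  have W: "unitary_mat n W" unfolding W_def by (intro unitary_mat_mult unitary_mat_adjoint Uu Vu)
  note c = unitary_matD[OF Uu] unitary_matD[OF Vu] unitary_matD[OF W]
  have D: "D \<in> carrier_mat n n" by (simp add: D_def)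
  have UW: "U * W = V" unfolding W_def using c by (simp flip: assoc_mult_mat[of _ n n _ n _ n])
  have "D = mat_adjoint W * D * W"
    using adjoint_mult_conjugate[OF Ac c(1) c(9)] UA VA UW by simp
  then have "W * D = W * (mat_adjoint W * (D * W))"
    using c D by (simp add: assoc_mult_mat[of _ n n _ n _ n])
  also have "\<dots> = D * W"
    using c D by (simp add: mult_carrier_mat[of _ n n _ n] flip: assoc_mult_mat[of W n n "mat_adjoint W" n "D * W" n])
  finally have comm: "W * D = D * W" .
  \<comment> \<open>Comparing entries of \<open>W * D\<close> and \<open>D * W\<close> multiplies
    the same entry of \<open>W\<close> by two different eigenvalues.\<close>
  have off: "W $$ (i, j) = 0" if "i < n" "i \<noteq> j" for i
  proof -
    have "W $$ (i, j) * complex_of_real (eigval_down A j) = complex_of_real (eigval_down A i) * W $$ (i, j)"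
      using arg_cong[OF comm, of "\<lambda>M. M $$ (i, j)"] that j
      unfolding D_def mat_diag_mult_left[OF c(9)] mat_diag_mult_right[OF c(9)] by simp
    moreover have "eigval_down A i \<noteq> eigval_down A j"
      using simple_spectrum_inj[OF A simple] that j by (auto simp: inj_on_def)
    ultimately show ?thesis by (simp add: mult.commute)
  qed
  have only: "(\<Sum>l<n. f l) = f j" if "\<And>l. l < n \<Longrightarrow> l \<noteq> j \<Longrightarrow> f l = 0" for f :: "nat \<Rightarrow> 'a::comm_monoid_add"
    using that j by (subst sum.remove[of _ j]) auto
  have "(cmod (W $$ (j, j)))\<^sup>2 = 1"
    using unitary_col_norm[OF W j] only[of "\<lambda>l. (cmod (W $$ (l, j)))\<^sup>2"] off by simp
  then have "cmod (W $$ (j, j)) = 1" by (simp add: power2_eq_1_iff) (metis norm_ge_zero not_one_le_zero neg_0_le_iff_le)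
  moreover have "col V j = W $$ (j, j) \<cdot>\<^sub>v col U j"
  proof (rule eq_vecI)
    fix l assume "l < dim_vec (W $$ (j, j) \<cdot>\<^sub>v col U j)"
    then have l: "l < n" using c by simp
    have "V $$ (l, j) = (\<Sum>i<n. U $$ (l, i) * W $$ (i, j))"
      unfolding UW[symmetric] by (rule index_mult_mat_sum[OF c(1) c(9) l j])
    also have "\<dots> = U $$ (l, j) * W $$ (j, j)" by (rule only) (simp add: off)
    finally show "col V j $ l = (W $$ (j, j) \<cdot>\<^sub>v col U j) $ l" using c l j by simp
  qed (use c in auto)
  ultimately show ?thesis by blast
qed

text \<open>The diagonal entry is a quadratic form in the column, so the phase meets its conjugate
  and cancels.\<close>

lemma diag_entry_conj_phase:
  assumes B: "B \<in> carrier_mat n n" and U: "U \<in> carrier_mat n n" and V: "V \<in> carrier_mat n n"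
    and j: "j < n" and c: "cmod c = 1" "col V j = c \<cdot>\<^sub>v col U j"
  shows "(mat_adjoint V * B * V) $$ (j, j) = (mat_adjoint U * B * U) $$ (j, j)"
proof -
  have entry: "(mat_adjoint M * B * M) $$ (j, j) =
      (\<Sum>l<n. \<Sum>m<n. cnj (M $$ (l, j)) * B $$ (l, m) * M $$ (m, j))"
    if M: "M \<in> carrier_mat n n" for M
  proof -
    have "(mat_adjoint M * B * M) $$ (j, j) = (mat_adjoint M * (B * M)) $$ (j, j)"
      using M B by (simp add: assoc_mult_mat[of _ n n _ n _ n])
    also have "\<dots> = (\<Sum>l<n. cnj (M $$ (l, j)) * (B * M) $$ (l, j))"
      by (rule index_adjoint_mult[of _ n n _ n]) (use M B j in auto)
    also have "\<dots> = (\<Sum>l<n. \<Sum>m<n. cnj (M $$ (l, j)) * B $$ (l, m) * M $$ (m, j))"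
      using index_mult_mat_sum[OF B M _ j] by (intro sum.cong) (auto simp: sum_distrib_left mult.assoc)
    finally show ?thesis .
  qed
  have "V $$ (l, j) = c * U $$ (l, j)" if "l < n" for l
    using arg_cong[OF c(2), of "\<lambda>w. w $ l"] that j U V by simp
  moreover have "cnj (c * x) * y * (c * z) = cnj x * y * z" for x y z
  proof -
    have "cnj (c * x) * y * (c * z) = (c * cnj c) * (cnj x * y * z)" by simp
    also have "c * cnj c = 1" unfolding complex_norm_square[symmetric] c(1) by simp
    finally show ?thesis by simp
  qed
  ultimately show ?thesis unfolding entry[OF U] entry[OF V] by (intro sum.cong) auto
qed

theorem theorem2:
  fixes A B :: "complex mat" and n :: nat
  assumes "hermitian_mat n A" and "hermitian_mat n B"
  shows "(\<exists>U. sorted_diagonalizes n U A \<and>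
            (\<forall>j<n. complex_of_real (delta B A $ j) = (mat_adjoint U * B * U) $$ (j, j))) \<and>
         (simple_spectrum A \<longrightarrow>
            (\<forall>U. sorted_diagonalizes n U A \<longrightarrow> sorted_eigenbasis n U A) \<and>
            (\<forall>U V. sorted_eigenbasis n U A \<and> sorted_eigenbasis n V A \<longrightarrow>
               (\<forall>j<n. \<exists>c::complex. cmod c = 1 \<and> col V j = c \<cdot>\<^sub>v col U j)) \<and>
            (\<forall>U. sorted_eigenbasis n U A \<longrightarrow>
               (\<forall>B'. hermitian_mat n B' \<longrightarrow>
                  (\<forall>j<n. complex_of_real (delta B' A $ j) = (mat_adjoint U * B' * U) $$ (j, j)))))"
proof -
  have Ac: "A \<in> carrier_mat n n" using assms by (simp add: hermitian_mat_def)
  note iff = sorted_diagonalizes_iff_eigenbasis[OF Ac]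
  have "complex_of_real (delta B' A $ j) = (mat_adjoint U * B' * U) $$ (j, j)"
    if simple: "simple_spectrum A" and U: "sorted_eigenbasis n U A"
      and B': "hermitian_mat n B'" and j: "j < n" for U B' j
  proof -
    \<comment> \<open>The basis \<open>V\<close> may depend on \<open>B'\<close>, but its columns
      differ from those of the given \<open>U\<close> only by phases.\<close>
    obtain V where V: "sorted_eigenbasis n V A"
      and d: "complex_of_real (delta B' A $ j) = (mat_adjoint V * B' * V) $$ (j, j)"
      using delta_diag_exists[OF assms(1) B'] j iff by blast
    obtain c where "cmod c = 1" "col V j = c \<cdot>\<^sub>v col U j"
      using sorted_eigenbasis_unique[OF assms(1) simple U V j] by blast
    then have "(mat_adjoint V * B' * V) $$ (j, j) = (mat_adjoint U * B' * U) $$ (j, j)"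
      using U V B' j
      by (intro diag_entry_conj_phase) (auto simp: sorted_eigenbasis_def hermitian_mat_def unitary_mat_def)
    with d show ?thesis by simp
  qed
  then show ?thesis
    using delta_diag_exists[OF assms] sorted_eigenbasis_unique[OF assms(1)] iff by blast
qed

end
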